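(* Let $S$ be an Arf numerical semigroup with multiplicity $5$ and conductor $s>5$. If $s\equiv 0\bmod 5$ and $S=\langle 5,s-2,s+1,s+2,s+4\rangle$, then $\mathrm{PF}(S)=\{s-7,s-4,s-3,s-1\}$, and the row-factorization matrices are exactly the following $5\times5$ matrices, described by their rows $r_1,\dots,r_5$ in order (where alternatives for different rows are chosen independently). For $s-7$ (one matrix): $r_1=(-1,1,0,0,0)$, $r_2=(\frac{s-10}{5},-1,1,0,0)$, $r_3=(\frac{s-10}{5},0,-1,0,1)$, $r_4=(\frac{2s-5}{5},0,0,-1,0)$, $r_5=(\frac{s-5}{5},0,0,1,-1)$. For $s-4$ (two matrices): $r_1=(-1,0,1,0,0)$, $r_2=(\frac{s-10}{5},-1,0,0,1)$, $r_3=(\frac{s-5}{5},0,-1,1,0)$, $r_4=(\frac{s}{5},1,0,-1,0)$, and $r_5=(\frac{2s}{5},0,0,0,-1)$ or $r_5=(0,1,0,1,-1)$. For $s-3$ (four matrices): $r_1=(-1,0,0,1,0)$, $r_2=(\frac{2s-5}{5},-1,0,0,0)$, $r_3=(\frac{s}{5},1,-1,0,0)$, $r_4=(\frac{s-5}{5},0,0,-1,1)$ or $r_4=(0,1,1,-1,0)$, and $r_5=(\frac{s}{5},0,1,0,-1)$ or $r_5=(1,2,0,0,-1)$. For $s-1$ (eight matrices): $r_1=(-1,0,0,0,1)$, $r_2=(\frac{s-5}{5},-1,0,1,0)$, $r_3=(\frac{2s}{5},0,-1,0,0)$ or $r_3=(0,1,-1,1,0)$, $r_4=(\frac{s}{5},0,1,-1,0)$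 or $r_4=(1,2,0,-1,0)$, and $r_5=(\frac{s+5}{5},1,0,0,-1)$ or $r_5=(0,0,1,1,-1)$.
   Context: A numerical semigroup is a subset $S\subseteq\mathbb{N}_0$ (non-negative integers) containing $0$, closed under addition, with finite complement in $\mathbb{N}_0$; $\langle A\rangle$ is the set of $\mathbb{N}_0$-linear combinations of elements of $A$. The multiplicity is the smallest nonzero element of $S$; the conductor is one plus the greatest integer not in $S$. $S$ is Arf if $s_2+s_3-s_1\in S$ for all $s_1\le s_2\le s_3$ in $S$. $\mathrm{PF}(S)$ is the set of integers $z\notin S$ with $z+x\in S$ for all nonzero $x\in S$. If $n_1<\dots<n_e$ are the minimal generators of $S$, a row-factorization matrix of $f\in\mathrm{PF}(S)$ is an $e\times e$ integer matrix $[a_{ij}]$ with $a_{ii}=-1$, $a_{ij}\in\mathbb{N}_0$ for $i\ne j$, and $f=\sum_{j=1}^e a_{ij}n_j$ for each $i$. *)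

theory Defs
  imports Complex_Main "Jordan_Normal_Form.Matrix"
begin

definition numerical_semigroup :: "nat set \<Rightarrow> bool" where
  "numerical_semigroup S \<longleftrightarrow>
     0 \<in> S \<and> (\<forall>x\<in>S. \<forall>y\<in>S. x + y \<in> S) \<and> finite (- S)"

definition generated :: "nat set \<Rightarrow> nat set" where
  "generated A = {\<Sum>a\<in>F. c a * a | F c. finite F \<and> F \<subseteq> A}"

definition multiplicity_sg :: "nat set \<Rightarrow> nat" where
  "multiplicity_sg S = (LEAST x. x \<in> S \<and> x \<noteq> 0)"

(* The greatest gap is taken among all integers, so that it is -1 (and the conductor 0)
   when S is the whole of the natural numbers. *)
definition conductor :: "nat set \<Rightarrow> int" where
  "conductor S = 1 + (GREATEST z::int. z \<notin> int ` S)"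

(* The truncated subtraction on nat is harmless here because s1 <= s3. *)
definition Arf :: "nat set \<Rightarrow> bool" where
  "Arf S \<longleftrightarrow>
     (\<forall>s1\<in>S. \<forall>s2\<in>S. \<forall>s3\<in>S. s1 \<le> s2 \<and> s2 \<le> s3 \<longrightarrow> s2 + s3 - s1 \<in> S)"

definition PF :: "nat set \<Rightarrow> int set" where
  "PF S = {z. z \<notin> int ` S \<and> (\<forall>x\<in>S. x \<noteq> 0 \<longrightarrow> z + int x \<in> int ` S)}"

definition minimal_generating_set :: "nat set \<Rightarrow> nat set \<Rightarrow> bool" where
  "minimal_generating_set A S \<longleftrightarrow>
     generated A = S \<and> (\<forall>B. B \<subset> A \<longrightarrow> generated B \<noteq> S)"

(* Well defined for every numerical semigroup, see ex1_minimal_generating_set below. *)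
definition minimal_generators :: "nat set \<Rightarrow> nat set" where
  "minimal_generators S = (THE A. minimal_generating_set A S)"

(* Rows and columns are indexed from 0, so ns ! j is the paper's n_(j+1). *)
definition RF_matrices :: "nat set \<Rightarrow> int \<Rightarrow> int mat set" where
  "RF_matrices S f =
     (let ns = sorted_list_of_set (minimal_generators S); e = length ns in
      {A \<in> carrier_mat e e. f \<in> PF S \<and>
         (\<forall>i<e. A $$ (i, i) = -1 \<and>
                (\<forall>j<e. j \<noteq> i \<longrightarrow> 0 \<le> A $$ (i, j)) \<and>
                f = (\<Sum>j<e. A $$ (i, j) * int (ns ! j)))})"

(* All matrices with 5 columns whose i-th row is chosen, independently of the other rows,
   from the i-th set of the list. *)
definition mats_with_rows :: "int list set list \<Rightarrow> int mat set" where
  "mats_with_rows Rs = mat_of_rows_list 5 ` listset Rs"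

lemma generated_zero: "0 \<in> generated A"
  unfolding generated_def by (auto intro!: exI[of _ "{}"])

lemma generated_base: "a \<in> A \<Longrightarrow> a \<in> generated A"
  unfolding generated_def by (auto intro!: exI[of _ "{a}"] exI[of _ "\<lambda>_. 1"])

lemma generated_add:
  assumes "x \<in> generated A" "y \<in> generated A"
  shows "x + y \<in> generated A"
proof -
  obtain F c where F: "finite F" "F \<subseteq> A" "x = (\<Sum>a\<in>F. c a * a)"
    using assms(1) unfolding generated_def by auto
  obtain G d where G: "finite G" "G \<subseteq> A" "y = (\<Sum>a\<in>G. d a * a)"
    using assms(2) unfolding generated_def by auto
  define h where "h a = (if a \<in> F then c a else 0) + (if a \<in> G then d a else 0)" for a
  have "x = (\<Sum>a\<in>F\<union>G. (if a \<in> F then c a else 0) * a)"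
    unfolding F(3) using F(1) G(1) by (intro sum.mono_neutral_cong_left) auto
  moreover have "y = (\<Sum>a\<in>F\<union>G. (if a \<in> G then d a else 0) * a)"
    unfolding G(3) using F(1) G(1) by (intro sum.mono_neutral_cong_left) auto
  ultimately have "x + y = (\<Sum>a\<in>F\<union>G. h a * a)"
    by (simp add: h_def sum.distrib distrib_right)
  then show ?thesis
    unfolding generated_def using F G
    by (auto intro!: exI[of _ "F \<union> G"] exI[of _ h])
qed

lemma generated_least:
  assumes "A \<subseteq> S" "0 \<in> S" "\<And>x y. x \<in> S \<Longrightarrow> y \<in> S \<Longrightarrow> x + y \<in> S"
  shows "generated A \<subseteq> S"
proof
  fix x assume "x \<in> generated A"
  then obtain F c where F: "finite F" "F \<subseteq> A" "x = (\<Sum>a\<in>F. c a * a)"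
    unfolding generated_def by auto
  have mult: "n * a \<in> S" if "a \<in> S" for n a
    by (induction n) (use assms that in auto)
  have "(\<Sum>a\<in>F. c a * a) \<in> S"
    using F(1,2) by (induction F) (use assms mult in auto)
  then show "x \<in> S" using F(3) by simp
qed

lemma ex1_minimal_generating_set:
  assumes "numerical_semigroup S"
  shows "\<exists>!A. minimal_generating_set A S"
proof -
  have S: "0 \<in> S" "\<And>x y. x \<in> S \<Longrightarrow> y \<in> S \<Longrightarrow> x + y \<in> S"
    using assms unfolding numerical_semigroup_def by auto
  define I where
    "I = {x\<in>S. x \<noteq> 0 \<and> (\<forall>a\<in>S. \<forall>b\<in>S. a \<noteq> 0 \<longrightarrow> b \<noteq> 0 \<longrightarrow> x \<noteq> a + b)}"
  have "x \<in> generated I" if "x \<in> S" for x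
    using that
  proof (induction x rule: less_induct)
    case (less x)
    show ?case
    proof (cases "x = 0 \<or> x \<in> I")
      case True
      then show ?thesis by (auto intro: generated_zero generated_base)
    next
      case False
      then obtain a b where "a \<in> S" "b \<in> S" "a \<noteq> 0" "b \<noteq> 0" "x = a + b"
        using less.prems unfolding I_def by blast
      then show ?thesis using less.IH[of a] less.IH[of b] by (auto intro: generated_add)
    qed
  qed
  then have gen: "generated I = S"
    using generated_least[of I S] S by (auto simp: I_def)
  have sub: "I \<subseteq> B" if B: "generated B = S" for B
  proof
    fix x assume x: "x \<in> I"
    define T where "T = {y. y = 0 \<or> (y \<in> S \<and> (\<exists>b\<in>B. b \<noteq> 0 \<and> (\<exists>z\<in>S. y = b + z)))}"
    have BS: "B \<subseteq> S" using generated_base[of _ B] B by auto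
    have "generated B \<subseteq> T"
    proof (rule generated_least)
      show "B \<subseteq> T" using BS S(1) unfolding T_def by force
      show "0 \<in> T" by (simp add: T_def)
      fix u v assume uv: "u \<in> T" "v \<in> T"
      show "u + v \<in> T"
      proof (cases "u = 0")
        case True then show ?thesis using uv by simp
      next
        case False
        then obtain b z where bz: "b \<in> B" "b \<noteq> 0" "z \<in> S" "u = b + z" "u \<in> S"
          using uv unfolding T_def by auto
        have "v \<in> S" using uv S(1) unfolding T_def by auto
        then have "u + v \<in> S" "z + v \<in> S" "u + v = b + (z + v)" using bz S(2) by auto
        then show ?thesis using bz unfolding T_def by blast
      qed
    qed
    then have "x \<in> T" using x B unfolding I_def by auto
    then obtain b z where bz: "b \<in> B" "b \<noteq> 0" "z \<in> S" "x = b + z"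
      using x unfolding T_def I_def by auto
    then have "z = 0" using x BS unfolding I_def by blast
    then show "x \<in> B" using bz by simp
  qed
  show ?thesis
  proof (rule ex1I[of _ I])
    show "minimal_generating_set I S"
      unfolding minimal_generating_set_def using gen sub by blast
    show "A = I" if "minimal_generating_set A S" for A
      using that gen sub unfolding minimal_generating_set_def by blast
  qed
qed

end

theory Submission
  imports Defs
begin

text \<open>
  Write \<open>s = 5 k\<close>; since \<open>s > 5\<close>, \<open>k \<ge> 2\<close>. The generators \<open>s - 2, s + 1, s + 2, s + 4\<close> lie in
  the four nonzero residue classes modulo 5, and adding multiples of 5 to them gives everything
  from \<open>s\<close> on. Hence \<open>S\<close> consists of the multiples of 5, the number \<open>s - 2\<close>, and all \<open>x \<ge> s\<close>
  (\<open>mem_generated_iff\<close>). This description makes the rest of the structure of \<open>S\<close> visible. A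
  pseudo-Frobenius number lies in \<open>S\<close> after adding 5 but not before, so it is one of
  \<open>-5, s - 7, s - 4, s - 3, s - 1\<close>, and \<open>-5\<close> is ruled out because \<open>s - 2\<close> lies in \<open>S\<close> and
  \<open>s - 7\<close> does not (\<open>PF_generated\<close>). None of the five generators is a sum of two
  nonzero elements of \<open>S\<close>, so they form the minimal generating set (\<open>minimal_generators_arf_gens\<close>).

  The conditions on a row-factorization matrix concern each row separately. The set of these
  matrices is therefore a product of five sets of admissible rows
  (\<open>RF_matrices_eq_mats_with_rows\<close>), and its size is the product of their sizes
  (\<open>card_mats_with_rows\<close>).

  Moving the entry \<open>-1\<close> of row \<open>i\<close> to the other side turns the row into a factorization of
  \<open>f + n\<^sub>i\<close>. As \<open>f \<le> s - 1\<close> and \<open>n\<^sub>i \<le> s + 4\<close>, this number is at most \<open>2 s + 3\<close>, which is less than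
  \<open>3 (s - 2)\<close> because \<open>s \<ge> 10\<close>. So at most two of the summands differ from 5
  (\<open>factorization_in_at_most_two\<close>). That leaves 15 possibilities for the last four coefficients,
  and for each of them the coefficient of 5 is the solution of a linear equation, which is
  integral and nonnegative only for the rows in the theorem.
\<close>

section \<open>Matrices with independently chosen rows\<close>

lemma mem_listset_iff: "xs \<in> listset As \<longleftrightarrow> list_all2 (\<in>) xs As"
  by (induction As arbitrary: xs) (auto simp: set_Cons_def list_all2_Cons2)

lemma card_listset: "card (listset As) = prod_list (map card As)"
proof (induction As)
  case (Cons A As)
  have "listset (A # As) = case_prod (#) ` (A \<times> listset As)"
    by (auto simp: set_Cons_def)
  moreover have "inj_on (case_prod (#)) (A \<times> listset As)"
    by (auto simp: inj_on_def)
  ultimately show ?case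
    using Cons.IH by (simp add: card_image card_cartesian_product)
qed simp

text \<open>
  The fixed row length matters: the matrix only records the first five entries of a row,
  and an entry beyond the end of a short row is unspecified, so otherwise different choices of
  rows could give the same matrix.
\<close>

lemma card_mats_with_rows:
  assumes "\<And>R r. R \<in> set Rs \<Longrightarrow> r \<in> R \<Longrightarrow> length r = 5"
  shows "card (mats_with_rows Rs) = prod_list (map card Rs)"
proof -
  have "inj_on (mat_of_rows_list 5) (listset Rs :: int list list set)"
  proof (rule inj_onI)
    fix xs ys :: "int list list"
    assume xs: "xs \<in> listset Rs" and ys: "ys \<in> listset Rs"
      and eq: "mat_of_rows_list 5 xs = mat_of_rows_list 5 ys"
    note X = xs[unfolded mem_listset_iff list_all2_conv_all_nth]
    note Y = ys[unfolded mem_listset_iff list_all2_conv_all_nth]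
    show "xs = ys"
    proof (rule nth_equalityI)
      show "length xs = length ys" using X Y by simp
      fix i assume i: "i < length xs"
      have len: "length (xs ! i) = 5" "length (ys ! i) = 5"
        using X Y i assms[OF nth_mem, of i] by auto
      show "xs ! i = ys ! i"
      proof (rule nth_equalityI)
        fix j assume "j < length (xs ! i)"
        moreover have "mat_of_rows_list 5 xs $$ (i, j) = mat_of_rows_list 5 ys $$ (i, j)"
          using eq by simp
        ultimately show "xs ! i ! j = ys ! i ! j"
          using i len X Y by (simp add: mat_of_rows_list_def)
      qed (use len in simp)
    qed
  qed
  then show ?thesis
    by (simp add: mats_with_rows_def card_image card_listset)
qed

section \<open>Row-factorization matrices row by row\<close>

definition RF_rows :: "nat list \<Rightarrow> int \<Rightarrow> nat \<Rightarrow> int list set" where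
  "RF_rows ns f i = {r. length r = length ns \<and> r ! i = -1 \<and>
     (\<forall>j<length ns. j \<noteq> i \<longrightarrow> 0 \<le> r ! j) \<and> f = (\<Sum>j<length ns. r ! j * int (ns ! j))}"

lemma RF_matrices_eq_mats_with_rows:
  assumes ns: "sorted_list_of_set (minimal_generators S) = ns" "length ns = 5"
    and f: "f \<in> PF S"
  shows "RF_matrices S f = mats_with_rows (map (RF_rows ns f) [0..<5])"
    (is "?L = mats_with_rows ?Rs")
proof (intro equalityI subsetI)
  fix A assume A: "A \<in> ?L"
  define xs where "xs = map (\<lambda>i. map (\<lambda>j. A $$ (i, j)) [0..<5]) [0..<5]"
  have dim: "dim_row A = 5" "dim_col A = 5"
    using A ns by (auto simp: RF_matrices_def Let_def)
  have "A = mat_of_rows_list 5 xs"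
    using dim by (intro eq_matI) (auto simp: xs_def mat_of_rows_list_def)
  moreover have "xs \<in> listset ?Rs"
    using A ns
    by (auto simp: mem_listset_iff list_all2_conv_all_nth xs_def RF_rows_def
        RF_matrices_def Let_def)
  ultimately show "A \<in> mats_with_rows ?Rs"
    by (auto simp: mats_with_rows_def)
next
  fix A assume "A \<in> mats_with_rows ?Rs"
  then obtain xs where A: "A = mat_of_rows_list 5 xs" and xs: "xs \<in> listset ?Rs"
    by (auto simp: mats_with_rows_def)
  then have len: "length xs = 5" and rows: "\<And>i. i < 5 \<Longrightarrow> xs ! i \<in> RF_rows ns f i"
    by (auto simp: mem_listset_iff list_all2_conv_all_nth)
  have "A $$ (i, j) = xs ! i ! j" if "i < 5" "j < 5" for i j
    using that len by (simp add: A mat_of_rows_list_def)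
  moreover have "A \<in> carrier_mat 5 5"
    using len by (simp add: A mat_of_rows_list_def)
  ultimately show "A \<in> ?L"
    using rows f ns by (auto simp: RF_matrices_def Let_def RF_rows_def)
qed

section \<open>Minimal generators\<close>

text \<open>
  If an atom \<open>x\<close> were missing from \<open>B\<close>, then \<open>S - {x}\<close> would contain \<open>B\<close> and still be closed under
  addition, so \<open>B\<close> could not generate \<open>x\<close>.
\<close>

lemma atom_in_generating_set:
  assumes gen: "generated B = S" and "x \<in> S" "x \<noteq> 0"
    and atom: "\<And>a b. a \<in> S \<Longrightarrow> b \<in> S \<Longrightarrow> a + b = x \<Longrightarrow> a = 0 \<or> b = 0"
  shows "x \<in> B"
proof (rule ccontr)
  assume "x \<notin> B"
  have "B \<subseteq> S" using gen generated_base by blast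
  have "generated B \<subseteq> S - {x}"
  proof (rule generated_least)
    show "B \<subseteq> S - {x}" using \<open>x \<notin> B\<close> \<open>B \<subseteq> S\<close> by blast
    show "0 \<in> S - {x}" using gen generated_zero \<open>x \<noteq> 0\<close> by blast
    fix u v assume "u \<in> S - {x}" "v \<in> S - {x}"
    then show "u + v \<in> S - {x}"
      using gen generated_add[of u B v] atom[of u v] by auto
  qed
  then show False using gen \<open>x \<in> S\<close> by blast
qed

lemma minimal_generators_eq_atoms:
  assumes S: "numerical_semigroup S" "S = generated A" and "0 \<notin> A"
    and atom: "\<And>x a b. x \<in> A \<Longrightarrow> a \<in> S \<Longrightarrow> b \<in> S \<Longrightarrow> a + b = x \<Longrightarrow> a = 0 \<or> b = 0"
  shows "minimal_generators S = A"
proof -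
  have "A \<subseteq> B" if "generated B = S" for B
    using that atom_in_generating_set[OF that] generated_base[of _ A] S(2) \<open>0 \<notin> A\<close> atom
    by (metis subsetI)
  then have "minimal_generating_set A S"
    using S(2) by (auto simp: minimal_generating_set_def)
  then show ?thesis
    unfolding minimal_generators_def
    using ex1_minimal_generating_set[OF S(1)] by (simp add: the1_equality)
qed

section \<open>The semigroup and its pseudo-Frobenius numbers\<close>

lemma mem_generated_iff:
  fixes k :: nat
  assumes "k \<ge> 2"
  shows "x \<in> generated {5, 5*k - 2, 5*k + 1, 5*k + 2, 5*k + 4}
    \<longleftrightarrow> 5 dvd x \<or> 5*k \<le> x \<or> x = 5*k - 2" (is "x \<in> generated ?A \<longleftrightarrow> ?P x")
proof
  have "generated ?A \<subseteq> {x. ?P x}"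
  proof (rule generated_least)
    show "?A \<subseteq> {x. ?P x}" by auto
    fix x y assume "x \<in> {x. ?P x}" "y \<in> {x. ?P x}"
    then have xy: "?P x" "?P y" by auto
    have ge5: "5 \<le> u" if "?P u" "u \<noteq> 0" for u
      using that assms by (auto simp: dvd_imp_le)
    (* If a summand is not a multiple of 5 it is at least 5k - 2, and the other one
       is 0 or at least 5. *)
    consider "x = 0" | "y = 0" | "5 dvd x" "5 dvd y" | "5 \<le> x" "5*k - 2 \<le> y" | "5 \<le> y" "5*k - 2 \<le> x"
      using xy ge5[of x] ge5[of y] by linarith
    then have "?P (x + y)"
      by cases (use xy assms in \<open>auto intro: dvd_add\<close>)
    then show "x + y \<in> {x. ?P x}" by simp
  qed simp
  then show "x \<in> generated ?A \<Longrightarrow> ?P x" by blast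
next
  have mult: "5 * m \<in> generated ?A" for m
    by (induction m) (auto intro: generated_zero generated_add generated_base)
  have shift: "x \<in> generated ?A" if "g \<in> ?A" "x = g + 5 * m" for g m
    using generated_add[OF generated_base[OF that(1)] mult] that(2) by simp
  assume P: "?P x"
  (* For residue 3 the class starts at 5k - 2, one period earlier than for the other residues. *)
  define q where "q = x div 5"
  have "x mod 5 \<in> {0, 1, 2, 3, 4}" by auto
  then consider "x = 5*q" | "x = 5*q + 1" | "x = 5*q + 2" | "x = 5*q + 3" | "x = 5*q + 4"
    using div_mult_mod_eq[of x 5] unfolding q_def by fastforce
  then show "x \<in> generated ?A"
  proof cases
    case 1 then show ?thesis using mult by simp
  next
    case 2
    then have "\<not> 5 dvd x" by presburger
    with P 2 assms have "x = (5*k + 1) + 5 * (q - k)" by linarith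
    then show ?thesis using shift by blast
  next
    case 3
    then have "\<not> 5 dvd x" by presburger
    with P 3 assms have "x = (5*k + 2) + 5 * (q - k)" by linarith
    then show ?thesis using shift by blast
  next
    case 4
    then have "\<not> 5 dvd x" by presburger
    with P 4 assms have "x = (5*k - 2) + 5 * (q + 1 - k)" by linarith
    then show ?thesis using shift by blast
  next
    case 5
    then have "\<not> 5 dvd x" by presburger
    with P 5 assms have "x = (5*k + 4) + 5 * (q - k)" by presburger
    then show ?thesis using shift by blast
  qed
qed

text \<open>
  Only two elements are needed to exclude all other candidates: adding 5 leaves, besides the four
  values, just \<open>-5\<close>, and adding \<open>5 k - 2\<close> to \<open>-5\<close> gives the gap \<open>5 k - 7\<close>. Conversely the four values
  are at least \<open>5 k - 7\<close>: adding 5 gives \<open>5 k - 2\<close> or a number above \<open>5 k\<close>, and so does adding any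
  other nonzero element, because it is at least 8.
\<close>

lemma PF_generated:
  fixes k :: nat
  assumes k: "k \<ge> 2"
    and S: "S = generated {5, 5*k - 2, 5*k + 1, 5*k + 2, 5*k + 4}"
  shows "PF S = {5 * int k - 7, 5 * int k - 4, 5 * int k - 3, 5 * int k - 1}"
proof -
  have mem: "z \<in> int ` S \<longleftrightarrow> 0 \<le> z \<and> (5 dvd z \<or> 5 * int k \<le> z \<or> z = 5 * int k - 2)" for z
  proof -
    have "z \<in> int ` S \<longleftrightarrow> 0 \<le> z \<and> nat z \<in> S"
      by (metis image_iff int_nat_eq nat_int of_nat_0_le_iff)
    then show ?thesis
      unfolding S mem_generated_iff[OF k] using k by presburger
  qed
  have memn: "x \<in> S \<longleftrightarrow> 5 dvd x \<or> 5*k \<le> x \<or> x = 5*k - 2" for x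
    unfolding S by (rule mem_generated_iff[OF k])
  show ?thesis
  proof (intro equalityI subsetI)
    fix z assume z: "z \<in> PF S"
    have "5 \<in> S" "5*k - 2 \<in> S" by (auto simp: memn)
    with z k have "z \<notin> int ` S" "z + 5 \<in> int ` S" "z + (5 * int k - 2) \<in> int ` S"
      by (force simp: PF_def)+
    then have lower: "z + 5 = 0 \<or> 5 * int k \<le> z + 5 \<or> z = 5 * int k - 7"
      and "z < 5 * int k" "z \<noteq> 5 * int k - 2" "\<not> (0 \<le> z \<and> 5 dvd z)"
      and "z + (5 * int k - 2) \<in> int ` S"
      unfolding mem by presburger+
    moreover have "z \<noteq> -5"
    proof
      assume "z = -5"
      with \<open>z + (5 * int k - 2) \<in> int ` S\<close> show False
        unfolding mem by presburger
    qed
    moreover have "z \<noteq> 5 * int k - 5"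
      using \<open>\<not> (0 \<le> z \<and> 5 dvd z)\<close> k by auto
    ultimately show "z \<in> {5 * int k - 7, 5 * int k - 4, 5 * int k - 3, 5 * int k - 1}"
      by auto
  next
    fix z assume z: "z \<in> {5 * int k - 7, 5 * int k - 4, 5 * int k - 3, 5 * int k - 1}"
    then have "\<not> 5 dvd z" "z < 5 * int k" "z \<noteq> 5 * int k - 2"
      by (auto; presburger)+
    then have "z \<notin> int ` S" unfolding mem by simp
    moreover have "z + int x \<in> int ` S" if "x \<in> S" "x \<noteq> 0" for x
    proof -
      have "x = 5 \<or> 7 \<le> x" using that(2) that(1)[unfolded memn] k
        by (cases "5 dvd x") (presburger, linarith)
      then show ?thesis using z k unfolding mem by auto
    qed
    ultimately show "z \<in> PF S" by (simp add: PF_def)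
  qed
qed

section \<open>Factorizations with few large summands\<close>

text \<open>
  The coefficients of the four generators other than 5, in a factorization using at most two of
  them, counted with multiplicity.
\<close>

definition at_most_two :: "(int \<times> int \<times> int \<times> int) set" where
  "at_most_two = {(b, c, d, e). 0 \<le> b \<and> 0 \<le> c \<and> 0 \<le> d \<and> 0 \<le> e \<and> b + c + d + e \<le> 2}"

lemma at_most_two_eq:
  "at_most_two = {(0,0,0,0), (1,0,0,0), (0,1,0,0), (0,0,1,0), (0,0,0,1),
    (2,0,0,0), (1,1,0,0), (1,0,1,0), (1,0,0,1), (0,2,0,0), (0,1,1,0), (0,1,0,1),
    (0,0,2,0), (0,0,1,1), (0,0,0,2)}"
proof (intro equalityI subsetI)
  fix v assume "v \<in> at_most_two"
  then obtain b c d e where v: "v = (b, c, d, e)" "0 \<le> b" "0 \<le> c" "0 \<le> d" "0 \<le> e"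
    and le: "b + c + d + e \<le> 2"
    unfolding at_most_two_def by auto
  then have "b \<in> {0,1,2}" "c \<in> {0,1,2}" "d \<in> {0,1,2}" "e \<in> {0,1,2}"
    by auto
  then show "v \<in> {(0,0,0,0), (1,0,0,0), (0,1,0,0), (0,0,1,0), (0,0,0,1),
    (2,0,0,0), (1,1,0,0), (1,0,1,0), (1,0,0,1), (0,2,0,0), (0,1,1,0), (0,1,0,1),
    (0,0,2,0), (0,0,1,1), (0,0,0,2)}"
    using le unfolding v(1) by - (elim insertE emptyE; simp)
qed (auto simp: at_most_two_def)

text \<open>
  Each of the four generators is at least \<open>s - 2\<close>, and three of them already exceed the bound since
  \<open>3 (s - 2) > 2 s + 3\<close> when \<open>s \<ge> 10\<close>.
\<close>

lemma factorization_in_at_most_two: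
  fixes a b c d e s :: int
  assumes "s \<ge> 10" "a \<ge> 0" "b \<ge> 0" "c \<ge> 0" "d \<ge> 0" "e \<ge> 0"
    and "a * 5 + b * (s - 2) + c * (s + 1) + d * (s + 2) + e * (s + 4) \<le> 2 * s + 3"
  shows "(b, c, d, e) \<in> at_most_two"
proof -
  have "b + c + d + e \<le> 2"
  proof (rule ccontr)
    assume "\<not> b + c + d + e \<le> 2"
    then have "3 * (s - 2) \<le> (b + c + d + e) * (s - 2)"
      using assms(1) by (intro mult_right_mono) auto
    then show False using assms by (simp add: algebra_simps)
  qed
  then show ?thesis using assms by (simp add: at_most_two_def)
qed

section \<open>The admissible rows\<close>

lemma RF_rows_five:
  "r \<in> RF_rows [n0, n1, n2, n3, n4] f i \<longleftrightarrow>
    (\<exists>a b c d e. r = [a, b, c, d, e] \<and> r ! i = -1 \<and>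
       (i \<noteq> 0 \<longrightarrow> 0 \<le> a) \<and> (i \<noteq> 1 \<longrightarrow> 0 \<le> b) \<and> (i \<noteq> 2 \<longrightarrow> 0 \<le> c) \<and>
       (i \<noteq> 3 \<longrightarrow> 0 \<le> d) \<and> (i \<noteq> 4 \<longrightarrow> 0 \<le> e) \<and>
       f = a * int n0 + b * int n1 + c * int n2 + d * int n3 + e * int n4)"
  (is "_ \<longleftrightarrow> ?R r")
proof -
  have len: "length [n0, n1, n2, n3, n4] = 5" by simp
  have all5: "(\<forall>j<5. P j) \<longleftrightarrow> P 0 \<and> P 1 \<and> P 2 \<and> P 3 \<and> P (4::nat)" for P
    by (simp add: numeral_eq_Suc All_less_Suc conj_ac)
  have set5: "{..<5::nat} = {0, 1, 2, 3, 4}" by auto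
  have "[a, b, c, d, e] \<in> RF_rows [n0, n1, n2, n3, n4] f i \<longleftrightarrow> ?R [a, b, c, d, e]" for a b c d e
    unfolding RF_rows_def mem_Collect_eq len all5 set5 by (simp add: add.assoc eq_commute[of _ i])
  moreover have "\<exists>a b c d e. r = [a, b, c, d, e]" if "length r = 5"
    using that by (auto simp: numeral_eq_Suc length_Suc_conv)
  moreover have "length r = 5" if "r \<in> RF_rows [n0, n1, n2, n3, n4] f i"
    using that by (simp add: RF_rows_def)
  ultimately show ?thesis
    by (smt (verit))
qed

definition arf_gens :: "nat \<Rightarrow> nat list" where
  "arf_gens k = [5, 5*k - 2, 5*k + 1, 5*k + 2, 5*k + 4]"

lemma RF_rows_arf_gens_iff:
  assumes k: "k \<ge> 2"
  shows "r \<in> RF_rows (arf_gens k) f i \<longleftrightarrow>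
    (\<exists>a b c d e. r = [a, b, c, d, e] \<and> r ! i = -1 \<and>
       (i \<noteq> 0 \<longrightarrow> 0 \<le> a) \<and> (i \<noteq> 1 \<longrightarrow> 0 \<le> b) \<and> (i \<noteq> 2 \<longrightarrow> 0 \<le> c) \<and>
       (i \<noteq> 3 \<longrightarrow> 0 \<le> d) \<and> (i \<noteq> 4 \<longrightarrow> 0 \<le> e) \<and>
       f = a * 5 + b * (5 * int k - 2) + c * (5 * int k + 1) + d * (5 * int k + 2) + e * (5 * int k + 4))"
proof -
  have "int (5 * k - 2) = 5 * int k - 2" using k by simp
  then show ?thesis unfolding arf_gens_def RF_rows_five by (simp add: add.commute)
qed

text \<open>
  The rule that reduces the computation of a set of rows to finitely many cases. Adding \<open>\<delta> i j\<close>
  to the entries replaces the \<open>-1\<close> at position \<open>i\<close> by 0, which yields the factorization of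
  \<open>f + n\<^sub>i\<close> that the row encodes; the bound on \<open>f\<close> makes it one with at most two large summands.
\<close>

lemma RF_rows_arf_gens_eqI:
  fixes k :: nat and f :: int
  defines "\<delta> \<equiv> \<lambda>i j :: nat. if i = j then 1 else 0 :: int"
  assumes k: "k \<ge> 2" and i: "i < 5" and f: "f \<le> 5 * int k - 1"
    and sound: "\<And>r. r \<in> R \<Longrightarrow> r \<in> RF_rows (arf_gens k) f i"
    and complete: "\<And>a b c d e. [a, b, c, d, e] ! i = -1 \<Longrightarrow> 0 \<le> a + \<delta> i 0 \<Longrightarrow>
      (b + \<delta> i 1, c + \<delta> i 2, d + \<delta> i 3, e + \<delta> i 4) \<in> at_most_two \<Longrightarrow>
      f = a * 5 + b * (5 * int k - 2) + c * (5 * int k + 1) + d * (5 * int k + 2)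
        + e * (5 * int k + 4) \<Longrightarrow> [a, b, c, d, e] \<in> R"
  shows "RF_rows (arf_gens k) f i = R"
proof (intro equalityI subsetI)
  fix r assume "r \<in> RF_rows (arf_gens k) f i"
  then obtain a b c d e where r: "r = [a, b, c, d, e]" "[a, b, c, d, e] ! i = -1"
    and nonneg: "i \<noteq> 0 \<longrightarrow> 0 \<le> a" "i \<noteq> 1 \<longrightarrow> 0 \<le> b" "i \<noteq> 2 \<longrightarrow> 0 \<le> c" "i \<noteq> 3 \<longrightarrow> 0 \<le> d" "i \<noteq> 4 \<longrightarrow> 0 \<le> e"
    and sum: "f = a * 5 + b * (5 * int k - 2) + c * (5 * int k + 1) + d * (5 * int k + 2)
        + e * (5 * int k + 4)"
    unfolding RF_rows_arf_gens_iff[OF k] by blast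
  have "i \<in> {0, 1, 2, 3, 4}" using i by auto
  then have pos: "0 \<le> a + \<delta> i 0" "0 \<le> b + \<delta> i 1" "0 \<le> c + \<delta> i 2" "0 \<le> d + \<delta> i 3" "0 \<le> e + \<delta> i 4"
    and "(a + \<delta> i 0) * 5 + (b + \<delta> i 1) * (5 * int k - 2) + (c + \<delta> i 2) * (5 * int k + 1)
      + (d + \<delta> i 3) * (5 * int k + 2) + (e + \<delta> i 4) * (5 * int k + 4) \<le> 2 * (5 * int k) + 3"
    using r(2) nonneg f k unfolding sum by (auto simp: \<delta>_def algebra_simps)
  then have "(b + \<delta> i 1, c + \<delta> i 2, d + \<delta> i 3, e + \<delta> i 4) \<in> at_most_two"
    using k by (intro factorization_in_at_most_two[of "5 * int k" "a + \<delta> i 0"]) simp_all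
  then show "r \<in> R"
    using complete r pos(1) sum by blast
qed (use sound in blast)

lemma upt_five: "[0..<5] = [0, 1, 2, 3, 4]"
  by (simp add: upt_rec)

text \<open>
  In each of the next four lemmas, the 15 cases fix the last four entries, and what remains is a
  linear equation for the first entry with \<open>k\<close> as a parameter. Most cases fail modulo 5, or because
  the first entry would be negative or, in the first row, different from \<open>-1\<close>.
\<close>

lemma RF_rows_s_minus_7:
  assumes k: "k \<ge> 2"
  shows "map (RF_rows (arf_gens k) (5 * int k - 7)) [0..<5] = [
    {[-1, 1, 0, 0, 0]},
    {[int k - 2, -1, 1, 0, 0]},
    {[int k - 2, 0, -1, 0, 1]},
    {[2 * int k - 1, 0, 0, -1, 0]},
    {[int k - 1, 0, 0, 1, -1]}]"
  by (simp only: upt_five list.map list.inject simp_thms, intro conjI RF_rows_arf_gens_eqI[OF k])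
    (use k in \<open>(auto simp: RF_rows_arf_gens_iff; fail) |
      (simp add: at_most_two_eq, elim disjE; clarsimp; presburger)\<close>)+

lemma RF_rows_s_minus_4:
  assumes k: "k \<ge> 2"
  shows "map (RF_rows (arf_gens k) (5 * int k - 4)) [0..<5] = [
    {[-1, 0, 1, 0, 0]},
    {[int k - 2, -1, 0, 0, 1]},
    {[int k - 1, 0, -1, 1, 0]},
    {[int k, 1, 0, -1, 0]},
    {[2 * int k, 0, 0, 0, -1], [0, 1, 0, 1, -1]}]"
  by (simp only: upt_five list.map list.inject simp_thms, intro conjI RF_rows_arf_gens_eqI[OF k])
    (use k in \<open>(auto simp: RF_rows_arf_gens_iff; fail) |
      (simp add: at_most_two_eq, elim disjE; clarsimp; presburger)\<close>)+

lemma RF_rows_s_minus_3: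
  assumes k: "k \<ge> 2"
  shows "map (RF_rows (arf_gens k) (5 * int k - 3)) [0..<5] = [
    {[-1, 0, 0, 1, 0]},
    {[2 * int k - 1, -1, 0, 0, 0]},
    {[int k, 1, -1, 0, 0]},
    {[int k - 1, 0, 0, -1, 1], [0, 1, 1, -1, 0]},
    {[int k, 0, 1, 0, -1], [1, 2, 0, 0, -1]}]"
  by (simp only: upt_five list.map list.inject simp_thms, intro conjI RF_rows_arf_gens_eqI[OF k])
    (use k in \<open>(auto simp: RF_rows_arf_gens_iff; fail) |
      (simp add: at_most_two_eq, elim disjE; clarsimp; presburger)\<close>)+

lemma RF_rows_s_minus_1:
  assumes k: "k \<ge> 2"
  shows "map (RF_rows (arf_gens k) (5 * int k - 1)) [0..<5] = [
    {[-1, 0, 0, 0, 1]},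
    {[int k - 1, -1, 0, 1, 0]},
    {[2 * int k, 0, -1, 0, 0], [0, 1, -1, 1, 0]},
    {[int k, 0, 1, -1, 0], [1, 2, 0, -1, 0]},
    {[int k + 1, 1, 0, 0, -1], [0, 0, 1, 1, -1]}]"
  by (simp only: upt_five list.map list.inject simp_thms, intro conjI RF_rows_arf_gens_eqI[OF k])
    (use k in \<open>(auto simp: RF_rows_arf_gens_iff; fail) |
      (simp add: at_most_two_eq, elim disjE; clarsimp; presburger)\<close>)+

section \<open>The row-factorization matrices\<close>

text \<open>
  Suppose a generator is a sum of two nonzero elements. It is not 5, both summands being at least
  5, so it is not a multiple of 5 and one summand is not either. That summand is at least
  \<open>5 k - 2\<close>, so the sum is at least \<open>5 k + 3\<close>, leaving only \<open>5 k + 4\<close>. The other summand would then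
  be 6 or less than 5, and none of these nonzero numbers lies in \<open>S\<close>.
\<close>

lemma minimal_generators_arf_gens:
  assumes k: "k \<ge> 2" and S: "numerical_semigroup S" "S = generated (set (arf_gens k))"
  shows "minimal_generators S = set (arf_gens k)"
proof (rule minimal_generators_eq_atoms[OF S])
  have mem: "x \<in> S \<longleftrightarrow> 5 dvd x \<or> 5*k \<le> x \<or> x = 5*k - 2" for x
    unfolding S(2) using mem_generated_iff[OF k] by (simp add: arf_gens_def)
  fix x a b assume x: "x \<in> set (arf_gens k)" and ab: "a \<in> S" "b \<in> S" "a + b = x"
  show "a = 0 \<or> b = 0"
  proof (rule ccontr)
    assume "\<not> (a = 0 \<or> b = 0)"
    then have ge: "5 \<le> a" "5 \<le> b"
      using ab k by (auto simp: mem dvd_imp_le)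
    moreover have "x = 5 \<or> \<not> 5 dvd x"
      using x k unfolding arf_gens_def list.set by (elim insertE emptyE; simp; presburger)
    moreover have "x \<le> 5 * k + 4" using x k by (auto simp: arf_gens_def)
    moreover have "a \<noteq> 6" "b \<noteq> 6" using ab k by (auto simp: mem; presburger)+
    moreover have "5 dvd x" if "5 dvd a" "5 dvd b" using that ab(3) by auto
    moreover have "x \<noteq> 5 * k + 3"
      using x k unfolding arf_gens_def list.set by (elim insertE emptyE; simp)
    ultimately show False
      using ab k unfolding mem by linarith
  qed
qed (use k in \<open>auto simp: arf_gens_def\<close>)

theorem proposition3p6:
  fixes S :: "nat set" and s :: nat
  assumes "numerical_semigroup S" and "Arf S"
    and "multiplicity_sg S = 5"
    and "conductor S = int s" and "s > 5"
    and "s mod 5 = 0"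
    and "S = generated {5, s - 2, s + 1, s + 2, s + 4}"
  shows "PF S = {int s - 7, int s - 4, int s - 3, int s - 1}
   \<and> RF_matrices S (int s - 7) = mats_with_rows
       [{[-1, 1, 0, 0, 0]},
        {[(int s - 10) div 5, -1, 1, 0, 0]},
        {[(int s - 10) div 5, 0, -1, 0, 1]},
        {[(2 * int s - 5) div 5, 0, 0, -1, 0]},
        {[(int s - 5) div 5, 0, 0, 1, -1]}]
   \<and> card (RF_matrices S (int s - 7)) = 1
   \<and> RF_matrices S (int s - 4) = mats_with_rows
       [{[-1, 0, 1, 0, 0]},
        {[(int s - 10) div 5, -1, 0, 0, 1]},
        {[(int s - 5) div 5, 0, -1, 1, 0]},
        {[int s div 5, 1, 0, -1, 0]},
        {[(2 * int s) div 5, 0, 0, 0, -1], [0, 1, 0, 1, -1]}]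
   \<and> card (RF_matrices S (int s - 4)) = 2
   \<and> RF_matrices S (int s - 3) = mats_with_rows
       [{[-1, 0, 0, 1, 0]},
        {[(2 * int s - 5) div 5, -1, 0, 0, 0]},
        {[int s div 5, 1, -1, 0, 0]},
        {[(int s - 5) div 5, 0, 0, -1, 1], [0, 1, 1, -1, 0]},
        {[int s div 5, 0, 1, 0, -1], [1, 2, 0, 0, -1]}]
   \<and> card (RF_matrices S (int s - 3)) = 4
   \<and> RF_matrices S (int s - 1) = mats_with_rows
       [{[-1, 0, 0, 0, 1]},
        {[(int s - 5) div 5, -1, 0, 1, 0]},
        {[(2 * int s) div 5, 0, -1, 0, 0], [0, 1, -1, 1, 0]},
        {[int s div 5, 0, 1, -1, 0], [1, 2, 0, -1, 0]},
        {[(int s + 5) div 5, 1, 0, 0, -1], [0, 0, 1, 1, -1]}]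
   \<and> card (RF_matrices S (int s - 1)) = 8"
proof -
  define k where "k = s div 5"
  have s: "s = 5 * k" and k: "k \<ge> 2"
    using assms(5,6) unfolding k_def by presburger+
  define ns where "ns = arf_gens k"
  have S: "S = generated (set ns)"
    using assms(7) by (simp add: ns_def arf_gens_def s)
  have "sorted ns" "distinct ns"
    using k by (auto simp: ns_def arf_gens_def)
  then have ns: "sorted_list_of_set (minimal_generators S) = ns"
    using minimal_generators_arf_gens[OF k assms(1)] S
    by (simp add: ns_def sorted_list_of_set.idem_if_sorted_distinct)
  have PF: "PF S = {int s - 7, int s - 4, int s - 3, int s - 1}"
    using PF_generated[OF k, of S] assms(7) by (simp add: s)
  have RF: "RF_matrices S f = mats_with_rows (map (RF_rows ns f) [0..<5])" if "f \<in> PF S" for f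
    using ns that by (intro RF_matrices_eq_mats_with_rows) (auto simp: ns_def arf_gens_def)
  have quotients: "(int s - 10) div 5 = int k - 2" "(2 * int s - 5) div 5 = 2 * int k - 1"
    "(int s - 5) div 5 = int k - 1" "int s div 5 = int k" "(2 * int s) div 5 = 2 * int k"
    "(int s + 5) div 5 = int k + 1"
    unfolding s by simp_all
  have M7: "RF_matrices S (int s - 7) = mats_with_rows
       [{[-1, 1, 0, 0, 0]},
        {[(int s - 10) div 5, -1, 1, 0, 0]},
        {[(int s - 10) div 5, 0, -1, 0, 1]},
        {[(2 * int s - 5) div 5, 0, 0, -1, 0]},
        {[(int s - 5) div 5, 0, 0, 1, -1]}]"
    using RF[of "int s - 7"] RF_rows_s_minus_7[OF k] unfolding quotients by (simp add: PF ns_def s)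
  have M4: "RF_matrices S (int s - 4) = mats_with_rows
       [{[-1, 0, 1, 0, 0]},
        {[(int s - 10) div 5, -1, 0, 0, 1]},
        {[(int s - 5) div 5, 0, -1, 1, 0]},
        {[int s div 5, 1, 0, -1, 0]},
        {[(2 * int s) div 5, 0, 0, 0, -1], [0, 1, 0, 1, -1]}]"
    using RF[of "int s - 4"] RF_rows_s_minus_4[OF k] unfolding quotients by (simp add: PF ns_def s)
  have M3: "RF_matrices S (int s - 3) = mats_with_rows
       [{[-1, 0, 0, 1, 0]},
        {[(2 * int s - 5) div 5, -1, 0, 0, 0]},
        {[int s div 5, 1, -1, 0, 0]},
        {[(int s - 5) div 5, 0, 0, -1, 1], [0, 1, 1, -1, 0]},
        {[int s div 5, 0, 1, 0, -1], [1, 2, 0, 0, -1]}]"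
    using RF[of "int s - 3"] RF_rows_s_minus_3[OF k] unfolding quotients by (simp add: PF ns_def s)
  have M1: "RF_matrices S (int s - 1) = mats_with_rows
       [{[-1, 0, 0, 0, 1]},
        {[(int s - 5) div 5, -1, 0, 1, 0]},
        {[(2 * int s) div 5, 0, -1, 0, 0], [0, 1, -1, 1, 0]},
        {[int s div 5, 0, 1, -1, 0], [1, 2, 0, -1, 0]},
        {[(int s + 5) div 5, 1, 0, 0, -1], [0, 0, 1, 1, -1]}]"
    using RF[of "int s - 1"] RF_rows_s_minus_1[OF k] unfolding quotients by (simp add: PF ns_def s)
  have "card (RF_matrices S (int s - 7)) = 1"
    unfolding M7 by (subst card_mats_with_rows) auto
  moreover have "card (RF_matrices S (int s - 4)) = 2"
    unfolding M4 by (subst card_mats_with_rows) auto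
  moreover have "card (RF_matrices S (int s - 3)) = 4"
    unfolding M3 by (subst card_mats_with_rows) auto
  moreover have "card (RF_matrices S (int s - 1)) = 8"
    unfolding M1 by (subst card_mats_with_rows) auto
  ultimately show ?thesis
    using PF M7 M4 M3 M1 by blast
qed

end
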